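(* Let $P \subseteq \mathbb{R}^d$ be a polytope written as $$P = \bigcap_{i=1}^n \{x \in \mathbb{R}^d \mid \langle a_i, x\rangle \le b_i\},$$ with $a_i \in \mathbb{R}^d$ and $b_i \in \mathbb{R}$. If every $b_i$ is either $0$ or $1$, and $a_i \in \mathbb{Z}^d$ whenever $b_i = 1$, then $L_P(s) = L_P(\lfloor s \rfloor)$ for all real $s \ge 0$.
   Context: For a polytope $P \subseteq \mathbb{R}^d$ and real $s > 0$, let $L_P(s) = \#(sP \cap \mathbb{Z}^d)$, where $sP = \{sx \mid x \in P\}$ and $\#$ denotes cardinality; by convention $L_P(0) = 1$. *)

theory Defs
  imports "HOL-Analysis.Analysis"
begin

definition integer_lattice :: "(real ^ 'd) set" where
  "integer_lattice = {x. \<forall>i. x $ i \<in> \<int>}"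

(* Intended for s >= 0 and a polytope P: then s P is bounded, so the set being counted
   is finite and card is its actual cardinality. *)
definition lattice_count :: "(real ^ 'd) set \<Rightarrow> real \<Rightarrow> nat" where
  "lattice_count P s =
     (if s = 0 then 1 else card ((\<lambda>x. s *\<^sub>R x) ` P \<inter> integer_lattice))"

end

theory Submission
  imports Defs
begin

text \<open>For \<open>s > 0\<close> the dilate \<open>sP\<close> is cut out by the inequalities \<open>a\<^sub>i \<bullet> x \<le> s b\<^sub>i\<close>. On lattice points
  the left-hand side is an integer whenever \<open>b\<^sub>i = 1\<close>, so \<open>s\<close> may be replaced by its floor. When
  the floor is \<open>0\<close> the inequalities describe the recession cone of \<open>P\<close>, which is \<open>{0}\<close> because
  \<open>P\<close> is bounded; this agrees with the convention for the count at \<open>0\<close>.\<close>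

lemma inner_integer_lattice:
  assumes "x \<in> integer_lattice" "y \<in> integer_lattice"
  shows "x \<bullet> y \<in> \<int>"
  using assms by (auto simp: integer_lattice_def inner_vec_def intro!: Ints_sum Ints_mult)

text \<open>Positivity makes scaling invertible and order preserving. At \<open>s = 0\<close> the
  right-hand side is a cone that can be larger than the image.\<close>

lemma scaleR_image_halfspaces:
  fixes a :: "'i \<Rightarrow> 'a::real_inner"
  assumes "s > 0"
  shows "(\<lambda>x. s *\<^sub>R x) ` (\<Inter>i\<in>I. {x. a i \<bullet> x \<le> b i}) = (\<Inter>i\<in>I. {x. a i \<bullet> x \<le> s * b i})"
proof (intro equalityI subsetI)
  fix y assume y: "y \<in> (\<Inter>i\<in>I. {x. a i \<bullet> x \<le> s * b i})"
  have "y = s *\<^sub>R (inverse s *\<^sub>R y)"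
    using assms by simp
  moreover have "inverse s *\<^sub>R y \<in> (\<Inter>i\<in>I. {x. a i \<bullet> x \<le> b i})"
    using y assms by (auto simp: field_simps)
  ultimately show "y \<in> (\<lambda>x. s *\<^sub>R x) ` (\<Inter>i\<in>I. {x. a i \<bullet> x \<le> b i})"
    by (rule image_eqI)
qed (use assms in auto)

text \<open>A nonzero \<open>y\<close> in the cone would put its whole ray into the bounded set:
  nonnegative multiples keep each inner product nonpositive, hence at most
  \<open>b i\<close>.\<close>

lemma bounded_halfspaces_imp_recession_cone_trivial:
  fixes a :: "'i \<Rightarrow> 'a::real_inner"
  assumes bounded: "bounded (\<Inter>i\<in>I. {x. a i \<bullet> x \<le> b i})"
    and nonneg: "\<And>i. i \<in> I \<Longrightarrow> b i \<ge> 0"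
  shows "(\<Inter>i\<in>I. {x. a i \<bullet> x \<le> 0}) = {0}"
proof -
  have "y = 0" if y: "\<And>i. i \<in> I \<Longrightarrow> a i \<bullet> y \<le> 0" for y
  proof (rule ccontr)
    assume "y \<noteq> 0"
    obtain B where B: "\<And>x. x \<in> (\<Inter>i\<in>I. {x. a i \<bullet> x \<le> b i}) \<Longrightarrow> norm x \<le> B"
      using bounded unfolding bounded_iff by blast
    \<comment> \<open>Chosen so that \<open>t *\<^sub>R y\<close> has norm
      \<open>\<bar>B\<bar> + 1\<close>, which exceeds \<open>B\<close>.\<close>
    define t where "t = (\<bar>B\<bar> + 1) / norm y"
    have "t \<ge> 0"
      by (simp add: t_def)
    have "a i \<bullet> (t *\<^sub>R y) \<le> b i" if "i \<in> I" for i
      using mult_nonneg_nonpos[OF \<open>t \<ge> 0\<close> y[OF that]] nonneg[OF that] by simp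
    then have "norm (t *\<^sub>R y) \<le> B"
      by (intro B) auto
    then show False
      using \<open>y \<noteq> 0\<close> by (simp add: t_def)
  qed
  then show ?thesis
    by auto
qed

theorem theorem2:
  fixes P :: "(real ^ 'd) set"
    and n :: nat
    and a :: "nat \<Rightarrow> real ^ 'd"
    and b :: "nat \<Rightarrow> real"
  assumes "polytope P"
    and "P = (\<Inter>i\<in>{1..n}. {x. a i \<bullet> x \<le> b i})"
    and "\<And>i. i \<in> {1..n} \<Longrightarrow> b i = 0 \<or> b i = 1"
    and "\<And>i. i \<in> {1..n} \<Longrightarrow> b i = 1 \<Longrightarrow> a i \<in> integer_lattice"
  shows "\<forall>s\<ge>0. lattice_count P s = lattice_count P (real_of_int \<lfloor>s\<rfloor>)"
proof (intro allI impI)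
  fix s :: real
  assume "s \<ge> 0"
  \<comment> \<open>Dilating the inequalities instead of the points lets the single formula
    \<open>count\<close> cover \<open>t = 0\<close>, which is needed when the floor of
    \<open>s\<close> is 0.\<close>
  define K where "K t = (\<Inter>i\<in>{1..n}. {x. a i \<bullet> x \<le> t * b i})" for t
  have cone: "K 0 = {0}"
    using bounded_halfspaces_imp_recession_cone_trivial[of a b "{1..n}"]
      polytope_imp_bounded[OF assms(1)] assms(2,3) by (force simp: K_def)
  have count: "lattice_count P t = card (K t \<inter> integer_lattice)" if "t \<ge> 0" for t
  proof (cases "t = 0")
    case True
    have "K 0 \<inter> integer_lattice = {0}"
      by (auto simp: cone integer_lattice_def)
    then show ?thesis
      by (simp add: True lattice_count_def)
  next
    case False
    with that have "(\<lambda>x. t *\<^sub>R x) ` P = K t"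
      unfolding assms(2) K_def by (intro scaleR_image_halfspaces) simp
    with False show ?thesis
      by (simp add: lattice_count_def)
  qed
  have "a i \<bullet> x \<le> s * b i \<longleftrightarrow> a i \<bullet> x \<le> real_of_int \<lfloor>s\<rfloor> * b i"
    if i: "i \<in> {1..n}" and x: "x \<in> integer_lattice" for i x
  proof (cases "b i = 1")
    case True
    then obtain k where "a i \<bullet> x = real_of_int k"
      using inner_integer_lattice[OF assms(4)[OF i] x] by (auto elim: Ints_cases)
    then show ?thesis
      by (simp add: True le_floor_iff)
  next
    case False
    \<comment> \<open>Here \<open>b i = 0\<close>, so both right-hand sides vanish and
      \<open>a i\<close> may be any real vector.\<close>
    with assms(3)[OF i] show ?thesis
      by simp
  qed
  then have "K s \<inter> integer_lattice = K (real_of_int \<lfloor>s\<rfloor>) \<inter> integer_lattice"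
    unfolding K_def by blast
  then show "lattice_count P s = lattice_count P (real_of_int \<lfloor>s\<rfloor>)"
    using \<open>s \<ge> 0\<close> by (simp add: count)
qed

end
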